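(* Let $\mathscr{H}$ be a reproducing kernel Hilbert space on a non-empty set $\mathscr{X}$, let $\theta\in[0,\frac{\pi}{2})$, let $n\ge1$, and let $S_j,T_j\in\Pi^{\mathbf{Ber},P}_{\theta}$, $j=1,2,\dots,n$, be such that $S_jT_j=T_jS_j$ for each $j$. Then $$\mathbf{ber}^2\Big(\sum_{j=1}^nS_jT_j\Big)\ \le\ (1+\sin^2\theta)^2\Big(\sum_{j=1}^n\mathbf{ber}^2(S_j)\Big)\Big(\sum_{j=1}^n\mathbf{ber}^2(T_j)\Big).$$
   Context: $\mathscr{H}$ is a complex separable reproducing kernel Hilbert space of complex-valued functions on a non-empty set $\mathscr{X}$: for every $\lambda\in\mathscr{X}$ evaluation at $\lambda$ is continuous, and $k_\lambda\in\mathscr{H}$ denotes the reproducing kernel, $\phi(\lambda)=\langle\phi,k_\lambda\rangle$ for all $\phi\in\mathscr{H}$. It is implicit that $k_\lambda\neq0$, and $\hat k_\lambda=k_\lambda/\|k_\lambda\|$. $\mathscr{B}(\mathscr{H})$ is the algebra of bounded linear operators on $\mathscr{H}$. For $A\in\mathscr{B}(\mathscr{H})$: $\Re(A)=\frac12(A+A^* )$, $\Im(A)=\frac1{2i}(A-A^* )$, $\Re^m(A)=(\Re(A))^m$, $\Im^m(A)=(\Im(A))^m$; the Berezin transform is $\widetilde A(\lambda)=\langle A\hat k_\lambda,\hat k_\lambda\rangle$; the Berezin range is $\mathbf{Ber}(A)=\{\widetilde A(\lambda):\lambda\in\mathscr{X}\}$; the Berezin number is $\mathbf{ber}(A)=\sup_{\lambda\in\mathscr{X}}|\widetilde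 A(\lambda)|$, and $\mathbf{ber}^m(A)=(\mathbf{ber}(A))^m$. For $\theta\in[0,\frac{\pi}{2})$, $S_\theta=\{z\in\mathbb{C}:|\arg z|\le\theta\}$ is the sector with vertex at the origin (vertex included) and semi-angle $\theta$; $\Pi^{\mathbf{Ber}}_\theta$ is the class of $A\in\mathscr{B}(\mathscr{H})$ with $\mathbf{Ber}(A)\subseteq S_\theta$; and $$\Pi^{\mathbf{Ber},P}_\theta=\{A\in\Pi^{\mathbf{Ber}}_\theta:\ \mathbf{ber}(\Re^m(A))\le\mathbf{ber}^m(\Re(A))\ \text{and}\ \mathbf{ber}(\Im^m(A))\le\mathbf{ber}^m(\Im(A))\ \text{for all } m\in\mathbb{N}\}.$$ *)

theory Defs
  imports "HOL-Analysis.Analysis" "HOL-Library.Function_Algebras"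
begin

text \<open>
  The non-empty set underlying the function space is the type \<open>'x\<close>.  A space of complex-valued
  functions is a carrier set \<open>H\<close> of functions \<open>'x \<Rightarrow> complex\<close> with an inner product \<open>ip\<close>; the
  values of \<open>ip\<close> outside \<open>H\<close> are irrelevant.  Sums, differences and zero of functions are the
  pointwise ones of \<^theory>\<open>HOL-Library.Function_Algebras\<close>.  In that theory \<open>A ^ m\<close> would be a
  pointwise power, so powers of operators are written with \<open>^^\<close>.
\<close>

type_synonym 'x cfun = "'x \<Rightarrow> complex"
type_synonym 'x inner_prod = "'x cfun \<Rightarrow> 'x cfun \<Rightarrow> complex"
type_synonym 'x operator = "'x cfun \<Rightarrow> 'x cfun"

definition fscale :: "complex \<Rightarrow> 'x cfun \<Rightarrow> 'x cfun" where
  "fscale c f = (\<lambda>x. c * f x)"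

definition fnorm :: "'x inner_prod \<Rightarrow> 'x cfun \<Rightarrow> real" where
  "fnorm ip f = sqrt (Re (ip f f))"

text \<open>The value 0 off the carrier is needed because \<^locale>\<open>Metric_space\<close> demands
  nonnegativity and symmetry on the whole type.\<close>

definition fdist :: "'x cfun set \<Rightarrow> 'x inner_prod \<Rightarrow> 'x cfun \<Rightarrow> 'x cfun \<Rightarrow> real" where
  "fdist H ip f g = (if f \<in> H \<and> g \<in> H then fnorm ip (f - g) else 0)"

definition kernel :: "'x cfun set \<Rightarrow> 'x inner_prod \<Rightarrow> 'x \<Rightarrow> 'x cfun" where
  "kernel H ip x = (THE k. k \<in> H \<and> (\<forall>f\<in>H. f x = ip f k))"

locale function_ip_space =
  fixes H :: "'x cfun set" and ip :: "'x inner_prod"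
  assumes zero_closed: "0 \<in> H"
    and add_closed: "f \<in> H \<Longrightarrow> g \<in> H \<Longrightarrow> f + g \<in> H"
    and scale_closed: "f \<in> H \<Longrightarrow> fscale c f \<in> H"
    and ip_add_left: "f \<in> H \<Longrightarrow> g \<in> H \<Longrightarrow> h \<in> H \<Longrightarrow> ip (f + g) h = ip f h + ip g h"
    and ip_scale_left: "f \<in> H \<Longrightarrow> g \<in> H \<Longrightarrow> ip (fscale c f) g = c * ip f g"
    and ip_commute: "f \<in> H \<Longrightarrow> g \<in> H \<Longrightarrow> ip g f = cnj (ip f g)"
    and ip_pos: "f \<in> H \<Longrightarrow> f \<noteq> 0 \<Longrightarrow> 0 < Re (ip f f)"
begin

lemma diff_eq: "f - g = f + fscale (-1) g"
  by (auto simp: fscale_def fun_eq_iff)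

lemma diff_closed: "f \<in> H \<Longrightarrow> g \<in> H \<Longrightarrow> f - g \<in> H"
  unfolding diff_eq by (intro add_closed scale_closed)

lemma ip_add_right: "f \<in> H \<Longrightarrow> g \<in> H \<Longrightarrow> h \<in> H \<Longrightarrow> ip h (f + g) = ip h f + ip h g"
  by (metis add_closed complex_cnj_add ip_add_left ip_commute)

lemma ip_scale_right: "f \<in> H \<Longrightarrow> g \<in> H \<Longrightarrow> ip g (fscale c f) = cnj c * ip g f"
  by (metis complex_cnj_mult ip_commute ip_scale_left scale_closed)

lemma ip_zero: "ip 0 0 = 0"
proof -
  have "ip 0 0 = ip (0 + 0) 0" by simp
  also have "\<dots> = ip 0 0 + ip 0 0" by (intro ip_add_left zero_closed)
  finally show ?thesis by simp
qed

lemma ip_self: "f \<in> H \<Longrightarrow> ip f f = complex_of_real (Re (ip f f))"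
  using ip_commute[of f f] by (simp add: complex_eq_iff)

lemma ip_nonneg: "f \<in> H \<Longrightarrow> 0 \<le> Re (ip f f)"
  using ip_pos[of f] ip_zero by (cases "f = 0") auto

lemma fnorm_sq: "f \<in> H \<Longrightarrow> (fnorm ip f)\<^sup>2 = Re (ip f f)"
  by (simp add: fnorm_def ip_nonneg)

lemma ip_Cauchy_Schwarz:
  assumes f: "f \<in> H" and g: "g \<in> H"
  shows "cmod (ip f g) \<le> fnorm ip f * fnorm ip g"
proof (cases "g = 0")
  case True
  have "ip f g = ip f (fscale 0 g)" using True by (simp add: fscale_def zero_fun_def)
  then have "ip f g = 0" using f g by (simp add: ip_scale_right)
  then show ?thesis by (simp add: fnorm_def f g ip_nonneg)
next
  case False
  define a where "a = Re (ip g g)"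
  have a: "a > 0" using ip_pos[OF g False] by (simp add: a_def)
  have ga: "ip g g = of_real a" using ip_self[OF g] by (simp add: a_def)
  define c where "c = - ip f g / of_real a"
  have cg: "fscale c g \<in> H" using g by (rule scale_closed)
  have gf: "ip g f = cnj (ip f g)" using ip_commute f g by blast
  have "ip (f + fscale c g) (f + fscale c g)
      = ip f f + cnj c * ip f g + c * ip g f + c * cnj c * ip g g"
    using f g cg by (simp add: ip_add_left ip_add_right ip_scale_left ip_scale_right
        add_closed algebra_simps)
  also have "\<dots> = ip f f - ip f g * cnj (ip f g) / of_real a"
    using a by (simp add: c_def ga gf field_simps)
  finally have "Re (ip (f + fscale c g) (f + fscale c g)) = Re (ip f f) - (cmod (ip f g))\<^sup>2 / a"
    by (simp add: complex_norm_square[symmetric] flip: of_real_power of_real_divide)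
  moreover have "0 \<le> Re (ip (f + fscale c g) (f + fscale c g))"
    using f cg by (intro ip_nonneg add_closed)
  ultimately have "(cmod (ip f g))\<^sup>2 \<le> Re (ip f f) * a"
    using a by (simp add: pos_divide_le_eq)
  also have "\<dots> = (fnorm ip f * fnorm ip g)\<^sup>2"
    by (simp add: power_mult_distrib fnorm_sq f g a_def)
  finally show ?thesis
    by (rule power2_le_imp_le) (simp add: fnorm_def f g ip_nonneg)
qed

lemma fnorm_triangle:
  assumes f: "f \<in> H" and g: "g \<in> H"
  shows "fnorm ip (f + g) \<le> fnorm ip f + fnorm ip g"
proof -
  have "Re (ip (f + g) (f + g)) = Re (ip f f) + 2 * Re (ip f g) + Re (ip g g)"
    using f g ip_commute[OF f g] by (simp add: ip_add_left ip_add_right add_closed)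
  also have "\<dots> \<le> (fnorm ip f)\<^sup>2 + 2 * (fnorm ip f * fnorm ip g) + (fnorm ip g)\<^sup>2"
    using complex_Re_le_cmod[of "ip f g"] ip_Cauchy_Schwarz[OF f g] by (simp add: fnorm_sq f g)
  also have "\<dots> = (fnorm ip f + fnorm ip g)\<^sup>2" by (simp add: power2_sum)
  finally show ?thesis
    unfolding fnorm_def[of ip "f + g"]
    by (intro real_le_lsqrt) (auto simp: fnorm_def f g ip_nonneg)
qed

lemma fnorm_minus_commute:
  assumes "f \<in> H" "g \<in> H"
  shows "fnorm ip (f - g) = fnorm ip (g - f)"
proof -
  have "f - g = fscale (-1) (g - f)" by (auto simp: fscale_def fun_eq_iff)
  then show ?thesis
    using assms by (simp add: fnorm_def ip_scale_left ip_scale_right scale_closed diff_closed)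
qed

sublocale Metric_space H "fdist H ip"
proof
  fix f g
  show "0 \<le> fdist H ip f g"
    by (simp add: fdist_def fnorm_def ip_nonneg diff_closed)
  show "fdist H ip f g = fdist H ip g f"
    by (simp add: fdist_def fnorm_minus_commute)
next
  fix f g assume fg: "f \<in> H" "g \<in> H"
  show "fdist H ip f g = 0 \<longleftrightarrow> f = g"
    using fg ip_pos[of "f - g"] diff_closed[OF fg] ip_zero
    by (cases "f = g") (auto simp: fdist_def fnorm_def)
next
  fix f g h assume fgh: "f \<in> H" "g \<in> H" "h \<in> H"
  have "f - h = (f - g) + (g - h)" by (simp add: fun_eq_iff)
  then show "fdist H ip f h \<le> fdist H ip f g + fdist H ip g h"
    using fgh fnorm_triangle[of "f - g" "g - h"] by (simp add: fdist_def diff_closed)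
qed

end

locale rkhs = function_ip_space H ip
  for H :: "'x cfun set" and ip :: "'x inner_prod" +
  assumes complete: "mcomplete"
    and separable: "separable_space mtopology"
    and continuous_evaluation: "continuous_map mtopology euclidean (\<lambda>f. f x)"
    and kernel_nonzero: "kernel H ip x \<noteq> 0"

text \<open>Operators are total functions on \<open>'x cfun\<close> of which only the restriction to \<open>H\<close> matters.\<close>

definition bounded_operators :: "'x cfun set \<Rightarrow> 'x inner_prod \<Rightarrow> 'x operator set" where
  "bounded_operators H ip = {A.
     (\<forall>f\<in>H. A f \<in> H) \<and>
     (\<forall>f\<in>H. \<forall>g\<in>H. A (f + g) = A f + A g) \<and>
     (\<forall>c. \<forall>f\<in>H. A (fscale c f) = fscale c (A f)) \<and>
     (\<exists>C. \<forall>f\<in>H. fnorm ip (A f) \<le> C * fnorm ip f)}"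

definition adjoint_op :: "'x cfun set \<Rightarrow> 'x inner_prod \<Rightarrow> 'x operator \<Rightarrow> 'x operator" where
  "adjoint_op H ip A g = (THE h. h \<in> H \<and> (\<forall>f\<in>H. ip (A f) g = ip f h))"

definition Re_op :: "'x cfun set \<Rightarrow> 'x inner_prod \<Rightarrow> 'x operator \<Rightarrow> 'x operator" where
  "Re_op H ip A f = fscale (1 / 2) (A f + adjoint_op H ip A f)"

definition Im_op :: "'x cfun set \<Rightarrow> 'x inner_prod \<Rightarrow> 'x operator \<Rightarrow> 'x operator" where
  "Im_op H ip A f = fscale (1 / (2 * \<i>)) (A f - adjoint_op H ip A f)"

definition normalized_kernel :: "'x cfun set \<Rightarrow> 'x inner_prod \<Rightarrow> 'x \<Rightarrow> 'x cfun" where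
  "normalized_kernel H ip x =
     fscale (complex_of_real (1 / fnorm ip (kernel H ip x))) (kernel H ip x)"

definition berezin_transform ::
    "'x cfun set \<Rightarrow> 'x inner_prod \<Rightarrow> 'x operator \<Rightarrow> 'x \<Rightarrow> complex" where
  "berezin_transform H ip A x =
     ip (A (normalized_kernel H ip x)) (normalized_kernel H ip x)"

definition berezin_range :: "'x cfun set \<Rightarrow> 'x inner_prod \<Rightarrow> 'x operator \<Rightarrow> complex set" where
  "berezin_range H ip A = range (berezin_transform H ip A)"

text \<open>For a bounded operator the supremum is over a non-empty bounded set of reals.\<close>

definition berezin_number :: "'x cfun set \<Rightarrow> 'x inner_prod \<Rightarrow> 'x operator \<Rightarrow> real" where
  "berezin_number H ip A = (SUP x. cmod (berezin_transform H ip A x))"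

definition sector :: "real \<Rightarrow> complex set" where
  "sector \<theta> = {z. z = 0 \<or> \<bar>Arg z\<bar> \<le> \<theta>}"

definition berezin_sectorial ::
    "'x cfun set \<Rightarrow> 'x inner_prod \<Rightarrow> real \<Rightarrow> 'x operator set" where
  "berezin_sectorial H ip \<theta> = {A \<in> bounded_operators H ip. berezin_range H ip A \<subseteq> sector \<theta>}"

definition berezin_sectorial_power ::
    "'x cfun set \<Rightarrow> 'x inner_prod \<Rightarrow> real \<Rightarrow> 'x operator set" where
  "berezin_sectorial_power H ip \<theta> = {A \<in> berezin_sectorial H ip \<theta>.
     \<forall>m::nat.
       berezin_number H ip (Re_op H ip A ^^ m) \<le> berezin_number H ip (Re_op H ip A) ^ m \<and>
       berezin_number H ip (Im_op H ip A ^^ m) \<le> berezin_number H ip (Im_op H ip A) ^ m}"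

end

theory Submission
  imports Defs
begin

text \<open>
  Write \<open>k\<close> for a normalized kernel.  Since \<open>S\<close> and \<open>T\<close> commute, Cauchy--Schwarz bounds
  \<open>\<bar>\<langle>S T k, k\<rangle>\<bar>\<close> both by \<open>\<parallel>T k\<parallel> \<parallel>S\<^sup>* k\<parallel>\<close> and by \<open>\<parallel>S k\<parallel> \<parallel>T\<^sup>* k\<parallel>\<close>.  In the product of the two bounds
  each factor \<open>\<parallel>A k\<parallel> \<parallel>A\<^sup>* k\<parallel>\<close> is at most \<open>(\<parallel>A k\<parallel>\<^sup>2 + \<parallel>A\<^sup>* k\<parallel>\<^sup>2) / 2\<close>, which by the parallelogram law
  is \<open>\<parallel>\<Re>(A) k\<parallel>\<^sup>2 + \<parallel>\<Im>(A) k\<parallel>\<^sup>2\<close>.  These two terms are Berezin transforms of \<open>\<Re>(A)\<^sup>2\<close> and \<open>\<Im>(A)\<^sup>2\<close>,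
  so the power hypothesis with exponent 2 and the sector condition bound their sum by
  \<open>(1 + sin\<^sup>2 \<theta>) ber\<^sup>2(A)\<close>.  Cauchy--Schwarz for finite sums finishes the proof.
\<close>

section \<open>Inner product and norm identities\<close>

context function_ip_space
begin

lemma fnorm_nonneg: "f \<in> H \<Longrightarrow> 0 \<le> fnorm ip f"
  by (simp add: fnorm_def ip_nonneg)

lemma fnorm_fscale:
  assumes "f \<in> H"
  shows "fnorm ip (fscale c f) = cmod c * fnorm ip f"
proof -
  have "ip (fscale c f) (fscale c f) = of_real ((cmod c)\<^sup>2) * ip f f"
    using assms complex_norm_square[of c]
    by (simp add: ip_scale_left ip_scale_right scale_closed mult.assoc)
  then show ?thesis
    by (simp add: fnorm_def real_sqrt_mult)
qed

lemma ip_diff_left: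
  assumes "f \<in> H" "g \<in> H" "h \<in> H"
  shows "ip (f - g) h = ip f h - ip g h"
  using assms unfolding diff_eq by (simp add: ip_add_left ip_scale_left scale_closed)

lemma ip_diff_right:
  assumes "f \<in> H" "g \<in> H" "h \<in> H"
  shows "ip h (f - g) = ip h f - ip h g"
  using assms unfolding diff_eq by (simp add: ip_add_right ip_scale_right scale_closed)

lemma ip_zero_left: "g \<in> H \<Longrightarrow> ip 0 g = 0"
  using ip_scale_left[OF zero_closed, of g 0] by (simp add: fscale_def zero_fun_def)

lemma sum_closed: "(\<And>j. j \<in> J \<Longrightarrow> f j \<in> H) \<Longrightarrow> (\<Sum>j\<in>J. f j) \<in> H"
  by (induction J rule: infinite_finite_induct) (auto intro: zero_closed add_closed)

lemma ip_sum_left: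
  assumes "\<And>j. j \<in> J \<Longrightarrow> f j \<in> H" "g \<in> H"
  shows "ip (\<Sum>j\<in>J. f j) g = (\<Sum>j\<in>J. ip (f j) g)"
  using assms
  by (induction J rule: infinite_finite_induct) (auto simp: ip_zero_left ip_add_left sum_closed)

text \<open>Testing with \<open>f = g - h\<close> makes the norm of the difference vanish. This
  gives the uniqueness half of the descriptions behind \<open>kernel\<close> and
  \<open>adjoint_op\<close>, and reduces identities between vectors to identities between inner
  products.\<close>

lemma ip_right_unique:
  assumes "g \<in> H" "h \<in> H" "\<And>f. f \<in> H \<Longrightarrow> ip f g = ip f h"
  shows "g = h"
proof -
  have "ip (g - h) (g - h) = 0"
    using assms by (simp add: ip_diff_right diff_closed)
  then have "g - h = 0"
    using ip_pos[of "g - h"] assms diff_closed by fastforce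
  then show ?thesis by simp
qed

lemma fnorm_add_sq:
  assumes "f \<in> H" "g \<in> H"
  shows "(fnorm ip (f + g))\<^sup>2 = (fnorm ip f)\<^sup>2 + 2 * Re (ip f g) + (fnorm ip g)\<^sup>2"
  using assms ip_commute[of f g]
  by (simp add: fnorm_sq add_closed ip_add_left ip_add_right)

lemma fnorm_diff_sq:
  assumes "f \<in> H" "g \<in> H"
  shows "(fnorm ip (f - g))\<^sup>2 = (fnorm ip f)\<^sup>2 - 2 * Re (ip f g) + (fnorm ip g)\<^sup>2"
  using assms ip_commute[of f g]
  by (simp add: fnorm_sq diff_closed ip_diff_left ip_diff_right)

section \<open>Closure properties of the bounded operators\<close>

lemma bounded_operators_closed: "A \<in> bounded_operators H ip \<Longrightarrow> f \<in> H \<Longrightarrow> A f \<in> H"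
  by (simp add: bounded_operators_def)

text \<open>The definition puts no sign on its constant; replacing it by its absolute value lets
  bounds be multiplied by it.\<close>

lemma bounded_operators_bound:
  assumes "A \<in> bounded_operators H ip"
  obtains C where "0 \<le> C" "\<And>f. f \<in> H \<Longrightarrow> fnorm ip (A f) \<le> C * fnorm ip f"
proof -
  obtain C where C: "\<And>f. f \<in> H \<Longrightarrow> fnorm ip (A f) \<le> C * fnorm ip f"
    using assms unfolding bounded_operators_def by blast
  have "fnorm ip (A f) \<le> \<bar>C\<bar> * fnorm ip f" if "f \<in> H" for f
    using C[OF that] mult_right_mono[OF abs_ge_self fnorm_nonneg[OF that], of C] by linarith
  then show ?thesis using that[of "\<bar>C\<bar>"] by simp
qed

lemma bounded_operators_comp:
  assumes A: "A \<in> bounded_operators H ip" and B: "B \<in> bounded_operators H ip"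
  shows "A \<circ> B \<in> bounded_operators H ip"
proof -
  obtain C where C: "0 \<le> C" "\<And>f. f \<in> H \<Longrightarrow> fnorm ip (A f) \<le> C * fnorm ip f"
    using bounded_operators_bound[OF A] by blast
  obtain D where D: "\<And>f. f \<in> H \<Longrightarrow> fnorm ip (B f) \<le> D * fnorm ip f"
    using bounded_operators_bound[OF B] by blast
  have "fnorm ip (A (B f)) \<le> C * D * fnorm ip f" if "f \<in> H" for f
    using C(2)[OF bounded_operators_closed[OF B that]] mult_left_mono[OF D[OF that] C(1)]
    by (simp add: mult.assoc)
  then show ?thesis
    using A B by (auto simp: bounded_operators_def)
qed

lemma bounded_operators_add:
  assumes A: "A \<in> bounded_operators H ip" and B: "B \<in> bounded_operators H ip"
  shows "(\<lambda>f. A f + B f) \<in> bounded_operators H ip"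
proof -
  obtain C where C: "\<And>f. f \<in> H \<Longrightarrow> fnorm ip (A f) \<le> C * fnorm ip f"
    using bounded_operators_bound[OF A] by blast
  obtain D where D: "\<And>f. f \<in> H \<Longrightarrow> fnorm ip (B f) \<le> D * fnorm ip f"
    using bounded_operators_bound[OF B] by blast
  have "fnorm ip (A f + B f) \<le> (C + D) * fnorm ip f" if "f \<in> H" for f
    using C[OF that] D[OF that] fnorm_triangle[OF bounded_operators_closed[OF A that]
        bounded_operators_closed[OF B that]] by (simp add: distrib_right)
  moreover have "A (f + g) + B (f + g) = (A f + B f) + (A g + B g)" if "f \<in> H" "g \<in> H" for f g
    using A B that by (simp add: bounded_operators_def algebra_simps)
  moreover have "A (fscale c f) + B (fscale c f) = fscale c (A f + B f)" if "f \<in> H" for c f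
    using A B that by (simp add: bounded_operators_def)
      (simp add: fscale_def fun_eq_iff algebra_simps)
  ultimately show ?thesis
    using A B by (auto simp: bounded_operators_def intro: add_closed)
qed

lemma bounded_operators_fscale:
  assumes A: "A \<in> bounded_operators H ip"
  shows "(\<lambda>f. fscale c (A f)) \<in> bounded_operators H ip"
proof -
  obtain C where C: "\<And>f. f \<in> H \<Longrightarrow> fnorm ip (A f) \<le> C * fnorm ip f"
    using bounded_operators_bound[OF A] by blast
  have "fnorm ip (fscale c (A f)) \<le> (cmod c * C) * fnorm ip f" if "f \<in> H" for f
    using mult_left_mono[OF C[OF that] norm_ge_zero[of c]]
    by (simp add: fnorm_fscale bounded_operators_closed[OF A that] mult.assoc)
  moreover have "fscale c (A (f + g)) = fscale c (A f) + fscale c (A g)" if "f \<in> H" "g \<in> H" for f g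
    using A that by (simp add: bounded_operators_def)
      (simp add: fscale_def fun_eq_iff algebra_simps)
  moreover have "fscale c (A (fscale d f)) = fscale d (fscale c (A f))" if "f \<in> H" for d f
    using A that by (simp add: bounded_operators_def)
      (simp add: fscale_def fun_eq_iff algebra_simps)
  ultimately show ?thesis
    using A by (auto simp: bounded_operators_def intro: scale_closed)
qed

end

section \<open>Riesz representation and adjoints\<close>

text \<open>The test point \<open>- a / (b + 1)\<close> stands in for the minimizer
  \<open>- a / b\<close>, so that \<open>b = 0\<close> needs no separate case. The quadratic is
  strictly negative there unless \<open>a = 0\<close>.\<close>

lemma quadratic_nonneg_linear_coeff:
  fixes a b :: real
  assumes "\<And>t. 0 \<le> 2 * t * a + t\<^sup>2 * b" "0 \<le> b"
  shows "a = 0"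
proof -
  have "0 \<le> 2 * (- a / (b + 1)) * a + (- a / (b + 1))\<^sup>2 * b"
    by (rule assms(1))
  also have "\<dots> = - (a\<^sup>2 * (b + 2) / (b + 1)\<^sup>2)"
    using assms(2) by (simp add: power2_eq_square divide_simps) (simp add: algebra_simps)
  finally have "a\<^sup>2 * (b + 2) \<le> 0"
    using assms(2) by (simp add: divide_le_0_iff)
  then show ?thesis
    using assms(2) by (simp add: mult_le_0_iff)
qed

context rkhs
begin

text \<open>The representing vector minimizes \<open>\<parallel>f\<parallel>\<^sup>2 - 2 Re (\<phi> f)\<close>; a minimizing sequence is Cauchy by
  the parallelogram law.\<close>

lemma Riesz_representation:
  assumes add: "\<And>f g. f \<in> H \<Longrightarrow> g \<in> H \<Longrightarrow> \<phi> (f + g) = \<phi> f + \<phi> g"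
    and scale: "\<And>c f. f \<in> H \<Longrightarrow> \<phi> (fscale c f) = c * \<phi> f"
    and bound: "\<And>f. f \<in> H \<Longrightarrow> cmod (\<phi> f) \<le> C * fnorm ip f"
  shows "\<exists>h\<in>H. \<forall>f\<in>H. \<phi> f = ip f h"
proof -
  define J where "J f = (fnorm ip f)\<^sup>2 - 2 * Re (\<phi> f)" for f
  define m where "m = Inf (J ` H)"
  \<comment> \<open>Completing the square: \<open>J f\<close> is at least
    \<open>(fnorm ip f - C)^2 - C^2\<close>, so the infimum \<open>m\<close> is finite.\<close>
  have "- C\<^sup>2 \<le> J f" if "f \<in> H" for f
  proof -
    have "Re (\<phi> f) \<le> C * fnorm ip f"
      using bound[OF that] complex_Re_le_cmod[of "\<phi> f"] by linarith
    moreover have "0 \<le> (fnorm ip f - C)\<^sup>2" by simp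
    ultimately show ?thesis
      unfolding J_def by (simp add: power2_diff algebra_simps)
  qed
  then have bdd: "bdd_below (J ` H)" by (auto intro!: bdd_belowI)
  have m_le: "m \<le> J f" if "f \<in> H" for f
    unfolding m_def using bdd that by (intro cInf_lower) auto
  have "\<exists>f\<in>H. J f < m + 1 / real (Suc n)" for n
  proof -
    have "Inf (J ` H) < m + 1 / real (Suc n)" by (simp add: m_def)
    then show ?thesis
      using zero_closed by (subst (asm) cInf_less_iff) (auto intro: bdd)
  qed
  then obtain s where s: "\<And>n. s n \<in> H" "\<And>n. J (s n) < m + 1 / real (Suc n)"
    by metis
  \<comment> \<open>With \<open>u\<close> the midpoint of \<open>f\<close> and \<open>g\<close>, the
    linear terms of \<open>2 * J f + 2 * J g - 4 * J u\<close> cancel and the parallelogram law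
    turns the rest into the squared distance; then \<open>m \<le> J u\<close>.\<close>
  have dist_sq: "(fnorm ip (f - g))\<^sup>2 \<le> 2 * (J f - m) + 2 * (J g - m)"
    if f: "f \<in> H" and g: "g \<in> H" for f g
  proof -
    define u where "u = fscale (1 / 2) (f + g)"
    have "u \<in> H" using f g by (simp add: u_def add_closed scale_closed)
    have "fnorm ip u = fnorm ip (f + g) / 2"
      using f g by (simp add: u_def fnorm_fscale add_closed)
    moreover have "\<phi> u = (\<phi> f + \<phi> g) / 2"
      using f g by (simp add: u_def scale add add_closed)
    ultimately have "4 * J u = (fnorm ip (f + g))\<^sup>2 - 4 * Re (\<phi> f + \<phi> g)"
      by (simp only: J_def) (simp add: power_divide field_simps)
    then show ?thesis
      using m_le[OF \<open>u \<in> H\<close>] by (simp add: J_def fnorm_add_sq fnorm_diff_sq f g)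
  qed
  have "MCauchy s"
    unfolding MCauchy_def
  proof (intro conjI allI impI)
    show "range s \<subseteq> H" using s(1) by auto
    fix e :: real assume e: "e > 0"
    \<comment> \<open>For indices from \<open>N\<close> on, \<open>dist_sq\<close> contributes at
      most \<open>2 / (N + 1)\<close> from each of the two vectors, hence
      \<open>4 / (N + 1)\<close>, which must fall below the square of \<open>e\<close>.\<close>
    obtain N :: nat where N: "4 / e\<^sup>2 < real N" using reals_Archimedean2 by blast
    have "Defs.fdist H ip (s n) (s n') < e" if n: "N \<le> n" "N \<le> n'" for n n'
    proof -
      have "1 / real (Suc n) \<le> 1 / real (Suc N)" "1 / real (Suc n') \<le> 1 / real (Suc N)"
        using n by (simp_all add: frac_le)
      then have "(fnorm ip (s n - s n'))\<^sup>2 \<le> 4 / real (Suc N)"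
        using dist_sq[OF s(1) s(1), of n n'] s(2)[of n] s(2)[of n'] by simp
      also have "\<dots> < e\<^sup>2"
      proof -
        have "4 < e\<^sup>2 * real N" using N e by (simp add: pos_divide_less_eq mult.commute)
        also have "\<dots> \<le> e\<^sup>2 * real (Suc N)" by (simp add: mult_left_mono)
        finally show ?thesis by (simp add: pos_divide_less_eq)
      qed
      finally show ?thesis
        using e s(1) by (simp add: Defs.fdist_def power2_less_imp_less)
    qed
    then show "\<exists>N. \<forall>n n'. N \<le> n \<longrightarrow> N \<le> n' \<longrightarrow> Defs.fdist H ip (s n) (s n') < e" by blast
  qed
  then obtain h where "limitin mtopology s h sequentially"
    using complete by (auto simp: mcomplete_def)
  then have h: "h \<in> H" and lim: "\<And>e. e > 0 \<Longrightarrow> \<exists>N. \<forall>n\<ge>N. Defs.fdist H ip (s n) h < e"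
    unfolding limit_metric_sequentially by (blast, metis)
  have "(\<lambda>n. fnorm ip (s n - h)) \<longlonglongrightarrow> 0"
    using lim by (auto simp: LIMSEQ_iff Defs.fdist_def s(1) h fnorm_nonneg diff_closed)
  have ip_lim: "(\<lambda>n. ip (s n) g) \<longlonglongrightarrow> ip h g" if g: "g \<in> H" for g
  proof (rule Lim_null_comparison[THEN LIM_zero_cancel])
    show "\<forall>\<^sub>F n in sequentially. cmod (ip (s n) g - ip h g) \<le> fnorm ip (s n - h) * fnorm ip g"
      using ip_Cauchy_Schwarz[of "s _ - h" g] s(1) h g
      by (auto intro!: always_eventually simp flip: ip_diff_left simp: diff_closed)
    show "(\<lambda>n. fnorm ip (s n - h) * fnorm ip g) \<longlonglongrightarrow> 0"
      using \<open>(\<lambda>n. fnorm ip (s n - h)) \<longlonglongrightarrow> 0\<close> by (rule tendsto_mult_left_zero)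
  qed
  \<comment> \<open>First variation of \<open>J\<close> in the direction \<open>g\<close>.
    Minimality is tested at \<open>s n\<close> perturbed by \<open>t\<close> times \<open>g\<close>,
    with error \<open>1 / (n + 1)\<close>, so that passing to the limit uses only the convergence of
    the inner products.\<close>
  have Re_eq: "Re (\<phi> g) = Re (ip g h)" if g: "g \<in> H" for g
  proof -
    have "Re (ip h g) - Re (\<phi> g) = 0"
    proof (rule quadratic_nonneg_linear_coeff)
      fix t :: real
      have "0 \<le> 2 * t * (Re (ip (s n) g) - Re (\<phi> g)) + t\<^sup>2 * (fnorm ip g)\<^sup>2 + 1 / real (Suc n)" for n
      proof -
        have "m \<le> J (s n + fscale (of_real t) g)"
          using s(1) g by (intro m_le add_closed scale_closed)
        also have "\<dots> = J (s n) + 2 * t * (Re (ip (s n) g) - Re (\<phi> g)) + t\<^sup>2 * (fnorm ip g)\<^sup>2"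
          using s(1)[of n] g
          by (simp add: J_def fnorm_add_sq scale_closed add scale ip_scale_right fnorm_fscale
              power_mult_distrib algebra_simps)
        finally show ?thesis using s(2)[of n] by simp
      qed
      moreover have "(\<lambda>n. 2 * t * (Re (ip (s n) g) - Re (\<phi> g)) + t\<^sup>2 * (fnorm ip g)\<^sup>2
            + 1 / real (Suc n))
          \<longlonglongrightarrow> 2 * t * (Re (ip h g) - Re (\<phi> g)) + t\<^sup>2 * (fnorm ip g)\<^sup>2 + 0"
        using LIMSEQ_inverse_real_of_nat
        by (intro tendsto_intros ip_lim g) (simp add: inverse_eq_divide)
      ultimately show "0 \<le> 2 * t * (Re (ip h g) - Re (\<phi> g)) + t\<^sup>2 * (fnorm ip g)\<^sup>2"
        using LIMSEQ_le_const by (metis (lifting) add.right_neutral)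
    qed simp
    then show ?thesis using ip_commute[OF g h] by simp
  qed
  \<comment> \<open>Complex linearity recovers the imaginary parts: they are, up to sign, the real
    parts at \<open>fscale \<i> f\<close>.\<close>
  have "\<phi> f = ip f h" if f: "f \<in> H" for f
    using Re_eq[OF f] Re_eq[OF scale_closed[OF f, of \<i>]] f h
    by (simp add: scale ip_scale_left complex_eq_iff)
  then show ?thesis using h by blast
qed

text \<open>Continuity at 0 bounds the evaluation by 1 on some ball of radius \<open>r\<close>, and
  homogeneity extends the bound to all of \<open>H\<close>.\<close>

lemma evaluation_bounded: "\<exists>C. \<forall>f\<in>H. cmod (f x) \<le> C * fnorm ip f"
proof -
  have "openin mtopology {f \<in> topspace mtopology. f x \<in> ball 0 1}"
    by (rule openin_continuous_map_preimage[OF continuous_evaluation]) simp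
  then obtain r where r: "r > 0" "mball 0 r \<subseteq> {f \<in> H. f x \<in> ball 0 1}"
    using zero_closed by (auto simp: openin_mtopology)
  have unit: "cmod (f x) < 1" if "f \<in> H" "fnorm ip f < r" for f
  proof -
    have "Defs.fdist H ip 0 f = fnorm ip f"
      using that zero_closed fnorm_minus_commute[OF zero_closed that(1)] by (simp add: Defs.fdist_def)
    then have "f \<in> mball 0 r" using that zero_closed by simp
    then show ?thesis using r(2) by auto
  qed
  have "cmod (f x) \<le> 2 / r * fnorm ip f" if f: "f \<in> H" for f
  proof (cases "f = 0")
    case True
    then show ?thesis using r(1) f by (simp add: fnorm_nonneg)
  next
    case False
    then have p: "0 < fnorm ip f" using ip_pos[OF f] by (simp add: fnorm_def)
    \<comment> \<open>Rescales \<open>f\<close> to norm \<open>r / 2\<close>, strictly inside the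
      ball; hence the constant \<open>2 / r\<close>.\<close>
    define c where "c = r / (2 * fnorm ip f)"
    have c: "c > 0" using p r(1) by (simp add: c_def)
    have "fnorm ip (fscale (of_real c) f) = r / 2"
      using p c by (simp add: fnorm_fscale f) (simp add: c_def)
    then have "cmod (fscale (of_real c) f x) < 1"
      using r(1) f by (intro unit scale_closed) auto
    then have "c * cmod (f x) < 1"
      using c by (simp add: fscale_def norm_mult)
    then show ?thesis using p r(1) by (simp add: c_def field_simps)
  qed
  then show ?thesis by blast
qed

text \<open>Riesz representation of the point evaluation, with uniqueness, shows that the
  description defining \<open>kernel\<close> denotes.\<close>

lemma kernel_closed: "kernel H ip x \<in> H"
proof -
  obtain C where "\<forall>f\<in>H. cmod (f x) \<le> C * fnorm ip f" using evaluation_bounded by blast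
  then obtain k where "k \<in> H" "\<forall>f\<in>H. f x = ip f k"
    using Riesz_representation[of "\<lambda>f. f x" C] by (auto simp: fscale_def)
  then have "\<exists>!k. k \<in> H \<and> (\<forall>f\<in>H. f x = ip f k)"
    using ip_right_unique by (intro ex1I[of _ k]) auto
  from theI'[OF this] show ?thesis by (simp add: kernel_def)
qed

lemma normalized_kernel_closed: "normalized_kernel H ip x \<in> H"
  by (simp add: normalized_kernel_def scale_closed kernel_closed)

lemma fnorm_normalized_kernel: "fnorm ip (normalized_kernel H ip x) = 1"
proof -
  have "0 < fnorm ip (kernel H ip x)"
    using ip_pos[OF kernel_closed kernel_nonzero] by (simp add: fnorm_def)
  then show ?thesis
    by (simp add: normalized_kernel_def fnorm_fscale kernel_closed norm_divide)
qed

text \<open>For fixed \<open>g\<close>, the functional sending \<open>f\<close> to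
  \<open>ip (A f) g\<close> is bounded by Cauchy--Schwarz; its unique Riesz vector is the value of
  the adjoint at \<open>g\<close>.\<close>

lemma adjoint_op:
  assumes A: "A \<in> bounded_operators H ip" and g: "g \<in> H"
  shows adjoint_op_closed: "adjoint_op H ip A g \<in> H"
    and adjoint_op_ip: "f \<in> H \<Longrightarrow> ip f (adjoint_op H ip A g) = ip (A f) g"
proof -
  obtain C where C: "\<And>f. f \<in> H \<Longrightarrow> fnorm ip (A f) \<le> C * fnorm ip f"
    using bounded_operators_bound[OF A] by blast
  have "\<exists>h\<in>H. \<forall>f\<in>H. ip (A f) g = ip f h"
  proof (rule Riesz_representation[where C = "C * fnorm ip g"])
    show "cmod (ip (A f) g) \<le> C * fnorm ip g * fnorm ip f" if "f \<in> H" for f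
      using ip_Cauchy_Schwarz[OF bounded_operators_closed[OF A that] g]
        mult_right_mono[OF C[OF that] fnorm_nonneg[OF g]] by (simp add: mult_ac)
  qed (use A g in \<open>auto simp: bounded_operators_def ip_add_left ip_scale_left\<close>)
  then obtain h where "h \<in> H" "\<forall>f\<in>H. ip (A f) g = ip f h" by blast
  then have "\<exists>!h. h \<in> H \<and> (\<forall>f\<in>H. ip (A f) g = ip f h)"
    using ip_right_unique by (intro ex1I[of _ h]) auto
  from theI'[OF this]
  show "adjoint_op H ip A g \<in> H" "f \<in> H \<Longrightarrow> ip f (adjoint_op H ip A g) = ip (A f) g"
    unfolding adjoint_op_def by (blast, metis (lifting))
qed

lemma adjoint_op_ip_left:
  assumes A: "A \<in> bounded_operators H ip" and f: "f \<in> H" and g: "g \<in> H"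
  shows "ip (adjoint_op H ip A f) g = ip f (A g)"
  using adjoint_op_ip[OF A f g] ip_commute[OF g adjoint_op_closed[OF A f]]
    ip_commute[OF bounded_operators_closed[OF A g] f] by simp

text \<open>The squared norm of \<open>adjoint_op H ip A f\<close> is the inner product of
  \<open>A (adjoint_op H ip A f)\<close> with \<open>f\<close>, so the adjoint inherits the constant
  of \<open>A\<close>. Linearity follows by testing against all vectors.\<close>

lemma bounded_operators_adjoint_op:
  assumes A: "A \<in> bounded_operators H ip"
  shows "adjoint_op H ip A \<in> bounded_operators H ip"
proof -
  obtain C where C: "0 \<le> C" "\<And>f. f \<in> H \<Longrightarrow> fnorm ip (A f) \<le> C * fnorm ip f"
    using bounded_operators_bound[OF A] by blast
  note closed = adjoint_op_closed[OF A] bounded_operators_closed[OF A]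
  have "fnorm ip (adjoint_op H ip A f) \<le> C * fnorm ip f" if f: "f \<in> H" for f
  proof -
    let ?g = "adjoint_op H ip A f"
    have "fnorm ip ?g * fnorm ip ?g = Re (ip (A ?g) f)"
      using closed(1)[OF f] by (simp add: fnorm_sq adjoint_op_ip[OF A f] flip: power2_eq_square)
    also have "\<dots> \<le> fnorm ip (A ?g) * fnorm ip f"
      using complex_Re_le_cmod[of "ip (A ?g) f"]
        ip_Cauchy_Schwarz[OF closed(2)[OF closed(1)[OF f]] f] by linarith
    also have "\<dots> \<le> (C * fnorm ip f) * fnorm ip ?g"
      using mult_right_mono[OF C(2)[OF closed(1)[OF f]] fnorm_nonneg[OF f]] by (simp add: mult_ac)
    \<comment> \<open>One factor \<open>fnorm ip ?g\<close> cancels; if it is zero, the claim holds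
      because \<open>C\<close> is nonnegative.\<close>
    finally show ?thesis
      using C(1) fnorm_nonneg[OF f] fnorm_nonneg[OF closed(1)[OF f]]
      by (cases "fnorm ip ?g = 0") (auto simp: mult_le_cancel_right)
  qed
  moreover have "adjoint_op H ip A (f + g) = adjoint_op H ip A f + adjoint_op H ip A g"
    if "f \<in> H" "g \<in> H" for f g
    using that by (intro ip_right_unique)
      (simp_all add: closed add_closed adjoint_op_ip[OF A] ip_add_right)
  moreover have "adjoint_op H ip A (fscale c f) = fscale c (adjoint_op H ip A f)"
    if "f \<in> H" for c f
    using that by (intro ip_right_unique)
      (simp_all add: closed scale_closed adjoint_op_ip[OF A] ip_scale_right)
  ultimately show ?thesis
    using closed(1) by (auto simp: bounded_operators_def)
qed

section \<open>Real and imaginary parts of an operator\<close>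

lemma bounded_operators_Re_op:
  "A \<in> bounded_operators H ip \<Longrightarrow> Re_op H ip A \<in> bounded_operators H ip"
  unfolding Re_op_def[abs_def]
  by (intro bounded_operators_fscale bounded_operators_add bounded_operators_adjoint_op)

lemma bounded_operators_Im_op:
  "A \<in> bounded_operators H ip \<Longrightarrow> Im_op H ip A \<in> bounded_operators H ip"
  unfolding Im_op_def[abs_def] diff_eq
  by (intro bounded_operators_fscale bounded_operators_add bounded_operators_adjoint_op)

lemma Re_op_selfadjoint:
  assumes "A \<in> bounded_operators H ip" "f \<in> H" "g \<in> H"
  shows "ip (Re_op H ip A f) g = ip f (Re_op H ip A g)"
  using assms
  by (simp add: Re_op_def ip_scale_left ip_scale_right ip_add_left ip_add_right add_closed
      adjoint_op_closed bounded_operators_closed adjoint_op_ip adjoint_op_ip_left)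

lemma Im_op_selfadjoint:
  assumes "A \<in> bounded_operators H ip" "f \<in> H" "g \<in> H"
  shows "ip (Im_op H ip A f) g = ip f (Im_op H ip A g)"
  using assms
  by (simp add: Im_op_def ip_scale_left ip_scale_right ip_diff_left ip_diff_right diff_closed
      adjoint_op_closed bounded_operators_closed adjoint_op_ip adjoint_op_ip_left field_simps)

section \<open>Berezin numbers\<close>

lemma bdd_above_berezin_transform:
  assumes A: "A \<in> bounded_operators H ip"
  shows "bdd_above (range (\<lambda>x. cmod (berezin_transform H ip A x)))"
proof -
  obtain C where C: "\<And>f. f \<in> H \<Longrightarrow> fnorm ip (A f) \<le> C * fnorm ip f"
    using bounded_operators_bound[OF A] by blast
  have "cmod (berezin_transform H ip A x) \<le> C" for x
    unfolding berezin_transform_def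
    using ip_Cauchy_Schwarz[OF bounded_operators_closed[OF A normalized_kernel_closed[of x]]
        normalized_kernel_closed[of x]] C[OF normalized_kernel_closed[of x]]
    by (simp add: fnorm_normalized_kernel)
  then show ?thesis by (auto intro!: bdd_aboveI)
qed

lemma berezin_transform_le_berezin_number:
  "A \<in> bounded_operators H ip \<Longrightarrow> cmod (berezin_transform H ip A x) \<le> berezin_number H ip A"
  unfolding berezin_number_def by (intro cSUP_upper bdd_above_berezin_transform) auto

lemma berezin_number_nonneg: "A \<in> bounded_operators H ip \<Longrightarrow> 0 \<le> berezin_number H ip A"
  using berezin_transform_le_berezin_number norm_ge_zero order_trans by blast

text \<open>Passing to the adjoint conjugates the Berezin transform.\<close>

lemma berezin_transform_Re_op:
  assumes "A \<in> bounded_operators H ip"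
  shows "berezin_transform H ip (Re_op H ip A) x = of_real (Re (berezin_transform H ip A x))"
proof -
  let ?k = "normalized_kernel H ip x"
  have k: "?k \<in> H" by (rule normalized_kernel_closed)
  have "ip (Re_op H ip A ?k) ?k = (ip (A ?k) ?k + cnj (ip (A ?k) ?k)) / 2"
    using assms k
    by (simp add: Re_op_def ip_scale_left ip_add_left add_closed adjoint_op_closed
        bounded_operators_closed adjoint_op_ip_left ip_commute[of "A ?k" ?k])
  then show ?thesis by (simp add: berezin_transform_def complex_add_cnj)
qed

lemma berezin_transform_Im_op:
  assumes "A \<in> bounded_operators H ip"
  shows "berezin_transform H ip (Im_op H ip A) x = of_real (Im (berezin_transform H ip A x))"
proof -
  let ?k = "normalized_kernel H ip x"
  have k: "?k \<in> H" by (rule normalized_kernel_closed)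
  have "ip (Im_op H ip A ?k) ?k = (ip (A ?k) ?k - cnj (ip (A ?k) ?k)) / (2 * \<i>)"
    using assms k
    by (simp add: Im_op_def ip_scale_left ip_diff_left diff_closed adjoint_op_closed
        bounded_operators_closed adjoint_op_ip_left ip_commute[of "A ?k" ?k])
  then show ?thesis by (simp add: berezin_transform_def complex_diff_cnj complex_eq_iff)
qed

lemma berezin_number_Re_op_le:
  assumes "A \<in> bounded_operators H ip"
  shows "berezin_number H ip (Re_op H ip A) \<le> berezin_number H ip A"
  unfolding berezin_number_def[of H ip "Re_op H ip A"]
proof (rule cSUP_least)
  fix x
  show "cmod (berezin_transform H ip (Re_op H ip A) x) \<le> berezin_number H ip A"
    using abs_Re_le_cmod[of "berezin_transform H ip A x"]
      berezin_transform_le_berezin_number[OF assms, of x]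
    by (simp add: berezin_transform_Re_op[OF assms])
qed simp

text \<open>In polar form \<open>Im z\<close> is \<open>cmod z * sin (Arg z)\<close>, and the sine
  is increasing up to \<open>pi / 2\<close>. The vertex is treated apart because
  \<open>sector\<close> admits it regardless of \<open>Arg\<close>.\<close>

lemma sector_abs_Im_le:
  assumes "z \<in> sector \<theta>" "\<theta> \<le> pi / 2"
  shows "\<bar>Im z\<bar> \<le> sin \<theta> * cmod z"
proof (cases "z = 0")
  case False
  then have arg: "\<bar>Arg z\<bar> \<le> \<theta>" using assms(1) by (simp add: sector_def)
  have "Im z = cmod z * sin (Arg z)"
    using Im_rcis[of "cmod z" "Arg z"] by (simp only: rcis_cmod_Arg)
  moreover have "\<bar>sin (Arg z)\<bar> = sin \<bar>Arg z\<bar>"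
    using Arg_bounded[of z] sin_ge_zero[of "\<bar>Arg z\<bar>"] by (cases "Arg z \<ge> 0") auto
  moreover have "sin \<bar>Arg z\<bar> \<le> sin \<theta>"
    using arg assms(2) by (intro sin_monotone_2pi_le) auto
  ultimately show ?thesis
    by (simp add: abs_mult mult.commute mult_left_mono)
qed simp

text \<open>The sector condition enters here, applied at each point before taking the supremum; this
  is the source of the factor \<open>sin \<theta>\<close>.\<close>

lemma berezin_number_Im_op_le:
  assumes "A \<in> berezin_sectorial H ip \<theta>" "0 \<le> \<theta>" "\<theta> \<le> pi / 2"
  shows "berezin_number H ip (Im_op H ip A) \<le> sin \<theta> * berezin_number H ip A"
  unfolding berezin_number_def[of H ip "Im_op H ip A"]
proof (rule cSUP_least)
  fix x
  have A: "A \<in> bounded_operators H ip" and "berezin_transform H ip A x \<in> sector \<theta>"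
    using assms(1) by (auto simp: berezin_sectorial_def berezin_range_def)
  then have "\<bar>Im (berezin_transform H ip A x)\<bar> \<le> sin \<theta> * cmod (berezin_transform H ip A x)"
    using assms(3) by (intro sector_abs_Im_le)
  also have "\<dots> \<le> sin \<theta> * berezin_number H ip A"
    using assms(2,3) by (intro mult_left_mono berezin_transform_le_berezin_number A sin_ge_zero) auto
  finally show "cmod (berezin_transform H ip (Im_op H ip A) x) \<le> sin \<theta> * berezin_number H ip A"
    by (simp add: berezin_transform_Im_op[OF A])
qed simp

text \<open>For symmetric \<open>B\<close> the squared norm of \<open>B k\<close> is the inner
  product of \<open>B (B k)\<close> with \<open>k\<close>, that is, a Berezin transform of the
  square of \<open>B\<close>. This gives the power hypothesis a quantity to control.\<close>

lemma fnorm_selfadjoint_sq_le: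
  assumes B: "B \<in> bounded_operators H ip"
    and sa: "\<And>f g. f \<in> H \<Longrightarrow> g \<in> H \<Longrightarrow> ip (B f) g = ip f (B g)"
  shows "(fnorm ip (B (normalized_kernel H ip x)))\<^sup>2 \<le> berezin_number H ip (B ^^ 2)"
proof -
  let ?k = "normalized_kernel H ip x"
  have k: "?k \<in> H" "B ?k \<in> H"
    using normalized_kernel_closed bounded_operators_closed[OF B] by auto
  have sq: "B ^^ 2 = B \<circ> B" by (simp add: numeral_2_eq_2)
  have "(fnorm ip (B ?k))\<^sup>2 = Re (berezin_transform H ip (B ^^ 2) x)"
    using k by (simp add: fnorm_sq berezin_transform_def sq sa)
  also have "\<dots> \<le> berezin_number H ip (B ^^ 2)"
    using complex_Re_le_cmod berezin_transform_le_berezin_number[OF bounded_operators_comp[OF B B]]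
    unfolding sq by (rule order_trans)
  finally show ?thesis .
qed

lemma fnorm_mult_adjoint_le:
  assumes A: "A \<in> berezin_sectorial_power H ip \<theta>" and \<theta>: "0 \<le> \<theta>" "\<theta> \<le> pi / 2"
  shows "fnorm ip (A (normalized_kernel H ip x)) *
      fnorm ip (adjoint_op H ip A (normalized_kernel H ip x))
    \<le> (1 + (sin \<theta>)\<^sup>2) * (berezin_number H ip A)\<^sup>2"
proof -
  let ?k = "normalized_kernel H ip x" and ?A' = "adjoint_op H ip A"
  let ?P = "Re_op H ip A" and ?Q = "Im_op H ip A" and ?b = "berezin_number H ip A"
  have sect: "A \<in> berezin_sectorial H ip \<theta>" and bd: "A \<in> bounded_operators H ip"
    using A by (auto simp: berezin_sectorial_power_def berezin_sectorial_def)
  have P: "?P \<in> bounded_operators H ip" and Q: "?Q \<in> bounded_operators H ip"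
    using bd by (simp_all add: bounded_operators_Re_op bounded_operators_Im_op)
  have k: "?k \<in> H" "A ?k \<in> H" "?A' ?k \<in> H"
    using bd by (auto intro: normalized_kernel_closed bounded_operators_closed adjoint_op_closed)
  have "(fnorm ip (?P ?k))\<^sup>2 \<le> berezin_number H ip (?P ^^ 2)"
    using P Re_op_selfadjoint[OF bd] by (rule fnorm_selfadjoint_sq_le)
  also have "\<dots> \<le> (berezin_number H ip ?P)\<^sup>2"
    using A by (simp add: berezin_sectorial_power_def)
  also have "\<dots> \<le> ?b\<^sup>2"
    by (intro power_mono berezin_number_Re_op_le berezin_number_nonneg bd P)
  finally have 1: "(fnorm ip (?P ?k))\<^sup>2 \<le> ?b\<^sup>2" .
  have "(fnorm ip (?Q ?k))\<^sup>2 \<le> berezin_number H ip (?Q ^^ 2)"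
    using Q Im_op_selfadjoint[OF bd] by (rule fnorm_selfadjoint_sq_le)
  also have "\<dots> \<le> (berezin_number H ip ?Q)\<^sup>2"
    using A by (simp add: berezin_sectorial_power_def)
  also have "\<dots> \<le> (sin \<theta> * ?b)\<^sup>2"
    by (intro power_mono berezin_number_Im_op_le[OF sect \<theta>] berezin_number_nonneg Q)
  finally have 2: "(fnorm ip (?Q ?k))\<^sup>2 \<le> (sin \<theta>)\<^sup>2 * ?b\<^sup>2"
    by (simp add: power_mult_distrib)
  \<comment> \<open>Parallelogram law: up to a factor of modulus 1, \<open>?P ?k\<close> and
    \<open>?Q ?k\<close> are half the sum and half the difference of \<open>A ?k\<close> and
    \<open>?A' ?k\<close>.\<close>
  have "(fnorm ip (A ?k))\<^sup>2 + (fnorm ip (?A' ?k))\<^sup>2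
      = 2 * ((fnorm ip (?P ?k))\<^sup>2 + (fnorm ip (?Q ?k))\<^sup>2)"
    using k by (simp add: Re_op_def Im_op_def fnorm_fscale add_closed diff_closed norm_mult
        norm_divide power_mult_distrib power_divide fnorm_add_sq fnorm_diff_sq field_simps)
  then have "(fnorm ip (A ?k))\<^sup>2 + (fnorm ip (?A' ?k))\<^sup>2 \<le> 2 * ((1 + (sin \<theta>)\<^sup>2) * ?b\<^sup>2)"
    using 1 2 by (simp add: algebra_simps)
  moreover have "2 * (fnorm ip (A ?k) * fnorm ip (?A' ?k))
      \<le> (fnorm ip (A ?k))\<^sup>2 + (fnorm ip (?A' ?k))\<^sup>2"
    using sum_squares_bound[of "fnorm ip (A ?k)" "fnorm ip (?A' ?k)"] by simp
  ultimately show ?thesis by linarith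
qed

lemma berezin_transform_commuting_product_le:
  assumes S: "S \<in> berezin_sectorial_power H ip \<theta>" and T: "T \<in> berezin_sectorial_power H ip \<theta>"
    and comm: "\<And>f. f \<in> H \<Longrightarrow> S (T f) = T (S f)" and \<theta>: "0 \<le> \<theta>" "\<theta> \<le> pi / 2"
  shows "cmod (berezin_transform H ip (\<lambda>f. S (T f)) x)
    \<le> (1 + (sin \<theta>)\<^sup>2) * (berezin_number H ip S * berezin_number H ip T)"
proof -
  let ?k = "normalized_kernel H ip x"
  let ?S' = "adjoint_op H ip S" and ?T' = "adjoint_op H ip T"
  have bd: "S \<in> bounded_operators H ip" "T \<in> bounded_operators H ip"
    using S T by (auto simp: berezin_sectorial_power_def berezin_sectorial_def)
  have k: "?k \<in> H" "S ?k \<in> H" "T ?k \<in> H" "?S' ?k \<in> H" "?T' ?k \<in> H"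
    using bd by (auto intro: normalized_kernel_closed bounded_operators_closed adjoint_op_closed)
  let ?z = "cmod (ip (S (T ?k)) ?k)"
  \<comment> \<open>The outer operator moves to the right-hand vector as its adjoint; commutativity
    then allows the same with the roles of \<open>S\<close> and \<open>T\<close> exchanged.\<close>
  have 1: "?z \<le> fnorm ip (T ?k) * fnorm ip (?S' ?k)"
    using ip_Cauchy_Schwarz[OF k(3,4)] by (simp add: adjoint_op_ip bd k)
  have 2: "?z \<le> fnorm ip (S ?k) * fnorm ip (?T' ?k)"
    using ip_Cauchy_Schwarz[OF k(2,5)] by (simp add: adjoint_op_ip bd k comm)
  have "?z\<^sup>2 \<le> (fnorm ip (T ?k) * fnorm ip (?S' ?k)) * (fnorm ip (S ?k) * fnorm ip (?T' ?k))"
    unfolding power2_eq_square by (intro mult_mono 1 2 mult_nonneg_nonneg fnorm_nonneg k norm_ge_zero)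
  \<comment> \<open>Multiplying the two estimates lets each operator be paired with its own
    adjoint.\<close>
  also have "\<dots> = (fnorm ip (S ?k) * fnorm ip (?S' ?k)) * (fnorm ip (T ?k) * fnorm ip (?T' ?k))"
    by (simp add: mult_ac)
  also have "\<dots> \<le> ((1 + (sin \<theta>)\<^sup>2) * (berezin_number H ip S)\<^sup>2)
      * ((1 + (sin \<theta>)\<^sup>2) * (berezin_number H ip T)\<^sup>2)"
    by (intro mult_mono fnorm_mult_adjoint_le S T \<theta> mult_nonneg_nonneg fnorm_nonneg k) auto
  also have "\<dots> = ((1 + (sin \<theta>)\<^sup>2) * (berezin_number H ip S * berezin_number H ip T))\<^sup>2"
    by (simp add: power_mult_distrib power2_eq_square mult_ac)
  finally show ?thesis
    unfolding berezin_transform_def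
    by (rule power2_le_imp_le) (simp add: berezin_number_nonneg bd)
qed

end

theorem theorem4p8:
  fixes H :: "('x \<Rightarrow> complex) set"
    and ip :: "('x \<Rightarrow> complex) \<Rightarrow> ('x \<Rightarrow> complex) \<Rightarrow> complex"
    and \<theta> :: real and n :: nat
    and S T :: "nat \<Rightarrow> ('x \<Rightarrow> complex) \<Rightarrow> ('x \<Rightarrow> complex)"
  assumes "rkhs H ip"
    and "0 \<le> \<theta>" and "\<theta> < pi / 2"
    and "1 \<le> n"
    and "\<And>j. j \<in> {1..n} \<Longrightarrow> S j \<in> berezin_sectorial_power H ip \<theta>"
    and "\<And>j. j \<in> {1..n} \<Longrightarrow> T j \<in> berezin_sectorial_power H ip \<theta>"
    and "\<And>j f. j \<in> {1..n} \<Longrightarrow> f \<in> H \<Longrightarrow> S j (T j f) = T j (S j f)"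
  shows "(berezin_number H ip (\<lambda>f. \<Sum>j=1..n. S j (T j f)))\<^sup>2
    \<le> (1 + (sin \<theta>)\<^sup>2)\<^sup>2 * (\<Sum>j=1..n. (berezin_number H ip (S j))\<^sup>2)
        * (\<Sum>j=1..n. (berezin_number H ip (T j))\<^sup>2)"
proof -
  interpret rkhs H ip by fact
  have \<theta>: "0 \<le> \<theta>" "\<theta> \<le> pi / 2" using assms(2,3) by auto
  have bd: "S j \<in> bounded_operators H ip" "T j \<in> bounded_operators H ip" if "j \<in> {1..n}" for j
    using assms(5,6)[OF that] by (auto simp: berezin_sectorial_power_def berezin_sectorial_def)
  define a where "a j = berezin_number H ip (S j)" for j
  define b where "b j = berezin_number H ip (T j)" for j
  let ?U = "\<lambda>f. \<Sum>j=1..n. S j (T j f)" and ?c = "1 + (sin \<theta>)\<^sup>2"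
  have pointwise: "cmod (berezin_transform H ip ?U x) \<le> ?c * (\<Sum>j=1..n. a j * b j)" for x
  proof -
    have "berezin_transform H ip ?U x = (\<Sum>j=1..n. berezin_transform H ip (\<lambda>f. S j (T j f)) x)"
      unfolding berezin_transform_def
      by (intro ip_sum_left bounded_operators_closed[OF bd(1)] bounded_operators_closed[OF bd(2)]
          normalized_kernel_closed)
    also have "cmod \<dots> \<le> (\<Sum>j=1..n. ?c * (a j * b j))"
      unfolding a_def b_def
      by (intro sum_norm_le berezin_transform_commuting_product_le assms(5-7) \<theta>)
    finally show ?thesis by (simp add: sum_distrib_left)
  qed
  then have "berezin_number H ip ?U \<le> ?c * (\<Sum>j=1..n. a j * b j)"
    unfolding berezin_number_def by (intro cSUP_least) auto
  \<comment> \<open>Needed for squaring the estimate. The pointwise bound itself shows that the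
    supremum is over a bounded set, so it dominates each nonnegative modulus.\<close>
  moreover have "0 \<le> berezin_number H ip ?U"
  proof -
    have "bdd_above (range (\<lambda>x. cmod (berezin_transform H ip ?U x)))"
      using pointwise by (rule bdd_aboveI2)
    from order_trans[OF norm_ge_zero cSUP_upper[OF UNIV_I this]] show ?thesis
      unfolding berezin_number_def .
  qed
  ultimately have "(berezin_number H ip ?U)\<^sup>2 \<le> ?c\<^sup>2 * (\<Sum>j=1..n. a j * b j)\<^sup>2"
    unfolding power_mult_distrib[symmetric] by (rule power_mono)
  also have "\<dots> \<le> ?c\<^sup>2 * ((\<Sum>j=1..n. (a j)\<^sup>2) * (\<Sum>j=1..n. (b j)\<^sup>2))"
    by (intro mult_left_mono Cauchy_Schwarz_ineq_sum) simp
  finally show ?thesis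
    by (simp add: a_def b_def mult.assoc)
qed

end
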